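(* Let $G$ be a finite abelian group acting on itself by translation, and let $H$ be a subgroup of $G$. Let $k$ be a positive integer. Suppose that $A=A_1\cup\dots\cup A_k$, where for each $i$ the set $A_i$ is contained in a coset $g_iH$ of $H$, these $k$ cosets being pairwise distinct. Suppose likewise that $B=B_1\cup\dots\cup B_k$, where for each $i$ the set $B_i$ is contained in a coset $g'_iH$ of $H$, these $k$ cosets being pairwise distinct. Suppose finally that for each $1\le i\le k$, the sets $A\setminus A_i$ and $B\setminus B_i$ are translates of each other (i.e. $B\setminus B_i=x+(A\setminus A_i)$ for some $x\in G$). Then $A$ and $B$ are $(k-1)$-indistinguishable.
   Context: For a subset $T\subseteq G$ and an integer $j\ge 0$, let $T^{(j)}$ denote the set of $j$-element subsets of $T$. The $j$-deck of $T$ is the multiset $\{\{\{g+U: g\in G\} : U\in T^{(j)}\}\}$ of all $j$-element subsets of $T$, each taken up to translation by $G$. Two subsets $T_1,T_2$ are $m$-indistinguishable if their $j$-decks coincide for all $j\le m$, and $m$-distinguishable otherwise. *)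

theory Defs
  imports "HOL-Algebra.Coset" "HOL-Library.Multiset" "HOL-Library.Ramsey"
begin

text \<open>
  HOL-Algebra writes groups multiplicatively: the translate \<open>g + U\<close> is the left coset
  \<open>g <#\<^bsub>G\<^esub> U\<close>, and \<open>nsets T j\<close> is the set of all \<open>j\<close>-element subsets of \<open>T\<close>.
\<close>

definition translation_class :: "('a, 'b) monoid_scheme \<Rightarrow> 'a set \<Rightarrow> 'a set set" where
  "translation_class G U = {g <#\<^bsub>G\<^esub> U | g. g \<in> carrier G}"

text \<open>
  \<open>mset_set\<close> of an infinite set is empty, so this is the intended notion for finite \<open>T\<close>,
  in particular for all subsets of a finite group.
\<close>

definition deck :: "('a, 'b) monoid_scheme \<Rightarrow> nat \<Rightarrow> 'a set \<Rightarrow> 'a set set multiset" where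
  "deck G j T = image_mset (translation_class G) (mset_set (nsets T j))"

definition indistinguishable ::
    "('a, 'b) monoid_scheme \<Rightarrow> nat \<Rightarrow> 'a set \<Rightarrow> 'a set \<Rightarrow> bool" where
  "indistinguishable G m T\<^sub>1 T\<^sub>2 \<longleftrightarrow> (\<forall>j\<le>m. deck G j T\<^sub>1 = deck G j T\<^sub>2)"

end

theory Submission
  imports Defs
begin

text \<open>
  This is Kelly's counting argument. The number \<open>s\<close> of cosets of \<open>H\<close> met by a set \<open>U\<close> is invariant
  under translation. If \<open>U \<subseteq> A\<close>, then \<open>U\<close> is contained in exactly \<open>k - s\<close> of the sets \<open>A - As i\<close>.
  So summing over \<open>i\<close> the multiplicity of the class of \<open>U\<close> in the deck of \<open>A - As i\<close> gives \<open>k - s\<close>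
  times its multiplicity in the deck of \<open>A\<close>. If \<open>U\<close> has fewer than \<open>k\<close> elements, then \<open>s < k\<close>,
  and the multiplicity in the deck of \<open>A\<close> is determined by the translation classes of the \<open>A - As i\<close>.
\<close>

definition cosets_met :: "('a, 'b) monoid_scheme \<Rightarrow> 'a set \<Rightarrow> 'a set \<Rightarrow> nat" where
  "cosets_met G H U = card ((\<lambda>u. u <#\<^bsub>G\<^esub> H) ` U)"

lemma cosets_met_le_card: "finite U \<Longrightarrow> cosets_met G H U \<le> card U"
  unfolding cosets_met_def by (rule card_image_le)

lemma l_coset_eq_image: "x <#\<^bsub>G\<^esub> U = (\<lambda>u. x \<otimes>\<^bsub>G\<^esub> u) ` U"
  by (auto simp: l_coset_def)

lemma count_deck:
  assumes "finite T"
  shows "count (deck G j T) C = card {U \<in> nsets T j. translation_class G U = C}"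
proof -
  have "finite (nsets T j)"
    using assms by (rule finite_imp_finite_nsets)
  then show ?thesis
    by (simp add: deck_def count_image_mset vimage_def Int_def conj_commute)
qed

context group
begin

lemma inj_on_l_coset:
  assumes "x \<in> carrier G"
  shows "inj_on (\<lambda>U. x <# U) (Pow (carrier G))"
proof (rule inj_on_inverseI)
  fix U assume "U \<in> Pow (carrier G)"
  then show "inv x <# (x <# U) = U"
    using assms by (simp add: lcos_m_assoc lcos_mult_one)
qed

lemma translation_class_l_coset:
  assumes "x \<in> carrier G" "U \<subseteq> carrier G"
  shows "translation_class G (x <# U) = translation_class G U"
proof -
  have "\<exists>h\<in>carrier G. g <# (x <# U) = h <# U" if "g \<in> carrier G" for g
    using that assms by (intro bexI[of _ "g \<otimes> x"]) (auto simp: lcos_m_assoc)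
  moreover have "\<exists>h\<in>carrier G. g <# U = h <# (x <# U)" if "g \<in> carrier G" for g
    using that assms by (intro bexI[of _ "g \<otimes> inv x"]) (auto simp: lcos_m_assoc m_assoc)
  ultimately show ?thesis
    unfolding translation_class_def by blast
qed

lemma translation_class_eqD:
  assumes "translation_class G U = translation_class G V" "V \<subseteq> carrier G"
  obtains x where "x \<in> carrier G" "V = x <# U"
proof -
  have "V = \<one> <# V"
    using assms(2) by (simp add: lcos_mult_one)
  then have "V \<in> translation_class G V"
    unfolding translation_class_def by blast
  then have "V \<in> translation_class G U"
    by (simp only: assms(1))
  then have "\<exists>x\<in>carrier G. V = x <# U"
    unfolding translation_class_def by blast
  then show thesis
    using that by blast
qed

text \<open>Translation by \<open>x\<close> matches the \<open>j\<close>-subsets of \<open>T\<close>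
  bijectively with those of \<open>x <# T\<close>, and each subset keeps its class.\<close>

lemma deck_l_coset:
  assumes "x \<in> carrier G" "T \<subseteq> carrier G"
  shows "deck G j (x <# T) = deck G j T"
proof -
  have sub: "nsets T j \<subseteq> Pow (carrier G)"
    using assms(2) by (auto simp: nsets_def)
  have "inj_on (\<lambda>u. x \<otimes> u) T"
    using assms by (auto intro!: inj_onI simp: subset_iff)
  then have "bij_betw (\<lambda>u. x \<otimes> u) T (x <# T)"
    by (simp add: bij_betw_def l_coset_eq_image)
  then have "nsets (x <# T) j = (\<lambda>U. x <# U) ` nsets T j"
    by (simp add: bij_betw_imp_surj_on[OF bij_betw_nsets] l_coset_eq_image)
  then have "mset_set (nsets (x <# T) j) = image_mset (\<lambda>U. x <# U) (mset_set (nsets T j))"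
    using inj_on_subset[OF inj_on_l_coset[OF assms(1)] sub] by (simp add: image_mset_mset_set)
  moreover have "translation_class G (x <# U) = translation_class G U"
    if "U \<in># mset_set (nsets T j)" for U
  proof -
    \<comment> \<open>If \<open>nsets T j\<close> is infinite, its \<open>mset_set\<close> is empty
      by default and the assumption on \<open>U\<close> is contradictory.\<close>
    have "U \<in> nsets T j"
      using that by (metis elem_mset_set empty_iff mset_set.infinite set_mset_empty)
    then show ?thesis
      using sub by (intro translation_class_l_coset[OF assms(1)]) auto
  qed
  ultimately show ?thesis
    by (simp add: deck_def multiset.map_comp comp_def cong: multiset.map_cong)
qed

text \<open>Left translation by \<open>x\<close> carries the cosets met by \<open>U\<close> onto
  those met by \<open>x <# U\<close>, and it is injective on subsets of the group.\<close>

lemma cosets_met_l_coset: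
  assumes "subgroup H G" "x \<in> carrier G" "U \<subseteq> carrier G"
  shows "cosets_met G H (x <# U) = cosets_met G H U"
proof -
  have H: "H \<subseteq> carrier G"
    using assms(1) by (rule subgroup.subset)
  have "(\<lambda>u. u <# H) ` (x <# U) = (\<lambda>V. x <# V) ` ((\<lambda>u. u <# H) ` U)"
    using assms H by (auto simp: l_coset_eq_image[of G x U] image_image lcos_m_assoc subset_iff
        intro!: image_cong)
  moreover have "(\<lambda>u. u <# H) ` U \<subseteq> Pow (carrier G)"
    using assms(3) H l_coset_subset_G by blast
  then have "inj_on (\<lambda>V. x <# V) ((\<lambda>u. u <# H) ` U)"
    by (rule inj_on_subset[OF inj_on_l_coset[OF assms(2)]])
  ultimately show ?thesis
    by (simp add: cosets_met_def card_image)
qed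

text \<open>Double counting of the pairs of an index \<open>i\<close> and a \<open>j\<close>-subset
  \<open>U\<close> of \<open>A\<close> in class \<open>C\<close> that avoids \<open>As i\<close>.
  The last assumption makes the number of such \<open>i\<close> the same for every
  \<open>U\<close>.\<close>

lemma sum_count_deck_Diff:
  fixes g :: "'i \<Rightarrow> 'a" and H A :: "'a set"
  assumes "finite (carrier G)" "subgroup H G" "finite I"
    and A: "A = (\<Union>i\<in>I. As i)"
    and g: "\<And>i. i \<in> I \<Longrightarrow> g i \<in> carrier G"
    and sub: "\<And>i. i \<in> I \<Longrightarrow> As i \<subseteq> g i <# H"
    and inj: "inj_on (\<lambda>i. g i <# H) I"
    and s: "\<And>U. \<lbrakk>U \<in> nsets A j; translation_class G U = C\<rbrakk> \<Longrightarrow> cosets_met G H U = s"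
  shows "(\<Sum>i\<in>I. count (deck G j (A - As i)) C) = (card I - s) * count (deck G j A) C"
proof -
  have "A \<subseteq> carrier G"
    using A g sub l_coset_subset_G[OF subgroup.subset[OF assms(2)]] by blast
  then have fin: "finite A"
    using assms(1) finite_subset by blast
  define F where "F = {U \<in> nsets A j. translation_class G U = C}"
  have finF: "finite F"
    using fin by (simp add: F_def finite_imp_finite_nsets)
  have avoided: "card {i \<in> I. U \<inter> As i = {}} = card I - s" if "U \<in> F" for U
  proof -
    have U: "U \<subseteq> A" "cosets_met G H U = s"
      using that s by (auto simp: F_def nsets_def)
    let ?J = "{i \<in> I. U \<inter> As i \<noteq> {}}"
    \<comment> \<open>Any element of a coset represents it, so the coset of \<open>u\<close> reveals
      the index of its part.\<close>
    have eq: "u <# H = g i <# H" if "i \<in> I" "u \<in> As i" for u i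
      using that sub[of i] g[of i] l_repr_independence[of u "g i" H] assms(2) by blast
    \<comment> \<open>The cosets met by \<open>U\<close> are exactly those indexed by
      \<open>?J\<close>; as they are distinct, \<open>?J\<close> has \<open>s\<close>
      elements.\<close>
    have "(\<lambda>u. u <# H) ` U = (\<lambda>i. g i <# H) ` ?J"
    proof (intro equalityI image_subsetI)
      fix u assume "u \<in> U"
      then show "u <# H \<in> (\<lambda>i. g i <# H) ` ?J"
        using U(1) A eq by blast
    next
      fix i assume "i \<in> ?J"
      then obtain u where "i \<in> I" "u \<in> U" "u \<in> As i"
        by blast
      then show "g i <# H \<in> (\<lambda>u. u <# H) ` U"
        using eq by (metis imageI)
    qed
    moreover have "inj_on (\<lambda>i. g i <# H) ?J"
      using inj by (rule inj_on_subset) auto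
    ultimately have "card ?J = s"
      using U(2) by (simp add: cosets_met_def card_image)
    moreover have "{i \<in> I. U \<inter> As i = {}} = I - ?J"
      by auto
    moreover have "card (I - ?J) = card I - card ?J"
      using assms(3) by (intro card_Diff_subset) auto
    ultimately show ?thesis
      by simp
  qed
  \<comment> \<open>A subset of \<open>A\<close> lies in \<open>A - As i\<close> exactly when it is
    disjoint from \<open>As i\<close>.\<close>
  have "(\<Sum>i\<in>I. count (deck G j (A - As i)) C) = (\<Sum>i\<in>I. card {U \<in> F. U \<inter> As i = {}})"
    using fin by (intro sum.cong refl)
      (auto simp: count_deck F_def nsets_def intro!: arg_cong[where f = card])
  also have "\<dots> = (\<Sum>U\<in>F. card {i \<in> I. U \<inter> As i = {}})"
    using sum_multicount_gen[OF assms(3) finF, of "\<lambda>i U. U \<inter> As i = {}"] by simp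
  also have "\<dots> = (card I - s) * card F"
    by (simp add: avoided)
  finally show ?thesis
    using fin by (simp add: count_deck F_def)
qed

end

theorem theorem2p1:
  fixes G :: "('a, 'b) monoid_scheme" (structure)
    and H A B :: "'a set"
    and k :: nat
    and As Bs :: "nat \<Rightarrow> 'a set"
    and g g' :: "nat \<Rightarrow> 'a"
  assumes "comm_group G" and "finite (carrier G)"
    and "subgroup H G"
    and "k > 0"
    and "A = (\<Union>i\<in>{1..k}. As i)"
    and "\<And>i. i \<in> {1..k} \<Longrightarrow> g i \<in> carrier G"
    and "\<And>i. i \<in> {1..k} \<Longrightarrow> As i \<subseteq> g i <# H"
    and "inj_on (\<lambda>i. g i <# H) {1..k}"
    and "B = (\<Union>i\<in>{1..k}. Bs i)"
    and "\<And>i. i \<in> {1..k} \<Longrightarrow> g' i \<in> carrier G"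
    and "\<And>i. i \<in> {1..k} \<Longrightarrow> Bs i \<subseteq> g' i <# H"
    and "inj_on (\<lambda>i. g' i <# H) {1..k}"
    and "\<And>i. i \<in> {1..k} \<Longrightarrow> \<exists>x\<in>carrier G. B - Bs i = x <# (A - As i)"
  shows "indistinguishable G (k - 1) A B"
proof -
  interpret comm_group G by fact
  have H: "H \<subseteq> carrier G"
    using assms(3) by (rule subgroup.subset)
  have A: "A \<subseteq> carrier G"
    using assms(5-7) l_coset_subset_G[OF H] by blast
  have B: "B \<subseteq> carrier G"
    using assms(9-11) l_coset_subset_G[OF H] by blast
  have "count (deck G j A) C = count (deck G j B) C" if j: "j \<le> k - 1" for j C
  proof -
    \<comment> \<open>Taking \<open>V\<close> over the whole group yields one \<open>s\<close> that
      serves both \<open>A\<close> and \<open>B\<close>.\<close>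
    have "\<exists>s<k. \<forall>V\<in>nsets (carrier G) j. translation_class G V = C \<longrightarrow> cosets_met G H V = s"
    proof (cases "\<exists>U\<in>nsets (carrier G) j. translation_class G U = C")
      case True
      then obtain U where U: "U \<subseteq> carrier G" "finite U" "card U = j" "translation_class G U = C"
        by (auto simp: nsets_def)
      \<comment> \<open>Positivity of \<open>k\<close> turns \<open>j \<le> k - 1\<close> into
        \<open>j < k\<close>, despite truncated subtraction.\<close>
      have "cosets_met G H U < k"
        using cosets_met_le_card[OF U(2), of G H] U(3) j assms(4) by linarith
      moreover have "cosets_met G H V = cosets_met G H U"
        if V: "V \<in> nsets (carrier G) j" "translation_class G V = C" for V
      proof -
        have "V \<subseteq> carrier G"
          using V(1) by (auto simp: nsets_def)
        then obtain x where "x \<in> carrier G" "V = x <# U"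
          using translation_class_eqD U(4) V(2) by metis
        then show ?thesis
          using cosets_met_l_coset[OF assms(3)] U(1) by simp
      qed
      ultimately show ?thesis
        by blast
    next
      \<comment> \<open>The condition on \<open>s\<close> is vacuous here, so \<open>s = 0\<close>
        will do.\<close>
      case False
      then show ?thesis
        using assms(4) by blast
    qed
    then obtain s where s: "s < k"
      "\<And>V. V \<in> nsets (carrier G) j \<Longrightarrow> translation_class G V = C \<Longrightarrow> cosets_met G H V = s"
      by blast
    have "(k - s) * count (deck G j A) C = (\<Sum>i\<in>{1..k}. count (deck G j (A - As i)) C)"
      using sum_count_deck_Diff[OF assms(2,3) finite_atLeastAtMost assms(5-8) s(2)] nsets_mono[OF A]
      by (simp add: subset_iff)
    also have "\<dots> = (\<Sum>i\<in>{1..k}. count (deck G j (B - Bs i)) C)"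
    proof (intro sum.cong refl)
      fix i assume "i \<in> {1..k}"
      then obtain x where "x \<in> carrier G" "B - Bs i = x <# (A - As i)"
        using assms(13) by blast
      then show "count (deck G j (A - As i)) C = count (deck G j (B - Bs i)) C"
        using deck_l_coset[OF _ subset_trans[OF Diff_subset A]] by simp
    qed
    also have "\<dots> = (k - s) * count (deck G j B) C"
      using sum_count_deck_Diff[OF assms(2,3) finite_atLeastAtMost assms(9-12) s(2)] nsets_mono[OF B]
      by (simp add: subset_iff)
    \<comment> \<open>The factor \<open>k - s\<close> is nonzero because \<open>s < k\<close>, so it
      cancels.\<close>
    finally show ?thesis
      using s(1) by simp
  qed
  then show ?thesis
    unfolding indistinguishable_def by (blast intro: multiset_eqI)
qed

end
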